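(* Let $k\ge 1$ be an integer. The number of nice order ideals of $P_{2k+1,2k+3}$ that contain the element $2k+2$ equals $\displaystyle\sum_{j=1}^{k}\frac{j}{j+1}\binom{2j}{j}\binom{2k-2j}{k-j}$.
   Context: For coprime positive integers $s,t$, let $P_{s,t}=\mathbb{N}^+\setminus\{k_1s+k_2t\mid k_1,k_2\in\mathbb{N}\}$ (with $\mathbb N=\{0,1,2,\dots\}$), partially ordered by the reflexive-transitive closure of the cover relation: $x$ covers $y$ (for $x,y\in P_{s,t}$) iff $x-y\in\{s,t\}$. An order ideal is a subset $I$ such that $y\in I$ and $x\preceq y$ imply $x\in I$. An order ideal $I$ is nice if there are no $x,y\in I$ with $x-y=1$. *)

theory Defs
  imports Complex_Main
begin

definition core_set :: "nat \<Rightarrow> nat \<Rightarrow> nat set" where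
  "core_set s t = {x. 0 < x} - {k1 * s + k2 * t | k1 k2. True}"

text \<open>\<open>covers s t x y\<close> says that \<open>x\<close> covers \<open>y\<close>; the condition \<open>x - y \<in> {s, t}\<close> is written
  additively because subtraction truncates on the naturals.\<close>

definition covers :: "nat \<Rightarrow> nat \<Rightarrow> nat \<Rightarrow> nat \<Rightarrow> bool" where
  "covers s t x y \<longleftrightarrow>
     x \<in> core_set s t \<and> y \<in> core_set s t \<and> (x = y + s \<or> x = y + t)"

text \<open>\<open>core_le s t x y\<close> is the order \<open>x \<preceq> y\<close> on \<open>core_set s t\<close>. As a relation on all naturals it is
  additionally reflexive outside \<open>core_set s t\<close>, which has no effect on its order ideals.\<close>

definition core_le :: "nat \<Rightarrow> nat \<Rightarrow> nat \<Rightarrow> nat \<Rightarrow> bool" where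
  "core_le s t = (\<lambda>x y. covers s t y x)\<^sup>*\<^sup>*"

definition order_ideal :: "nat \<Rightarrow> nat \<Rightarrow> nat set \<Rightarrow> bool" where
  "order_ideal s t I \<longleftrightarrow>
     I \<subseteq> core_set s t \<and> (\<forall>y\<in>I. \<forall>x\<in>core_set s t. core_le s t x y \<longrightarrow> x \<in> I)"

definition nice :: "nat set \<Rightarrow> bool" where
  "nice I \<longleftrightarrow> \<not> (\<exists>x\<in>I. \<exists>y\<in>I. x = y + 1)"

end

theory Submission
  imports Defs "HOL-Computational_Algebra.Formal_Power_Series"
begin

text \<open>Sort \<open>core_set (2 * k + 1) (2 * k + 3)\<close> by residues modulo \<open>2 * k + 1\<close>. In an order ideal the
  elements of each residue class form an initial segment, and an ideal is nice iff no two adjacent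
  residues are both occupied. Hence, for each \<open>i < k\<close>, at most one of the classes of \<open>2 * i + 1\<close>
  and \<open>2 * i + 2\<close> is occupied, and the ideal is encoded by the walk \<open>zs\<close> in which \<open>zs ! i\<close> is the
  size of the class of \<open>2 * i + 2\<close> minus that of \<open>2 * i + 1\<close>. The number of walks with prescribed
  start and a lower bound on the end is a single binomial coefficient, so the ideals are counted by
  the partial row sum of \<open>(2 * k + 1) choose r\<close> over \<open>r \<ge> k + 2\<close>. By Vandermonde's identity for the
  exponents \<open>- 1 / 2\<close> and \<open>1 / 2\<close> the claimed convolution has the same value
  \<open>4 ^ k - ((2 * k + 1) choose (k + 1))\<close>.\<close>

subsection \<open>Binomial sums\<close>

lemma central_binomial_Suc:
  "Suc n * ((2 * Suc n) choose Suc n) = 2 * (2 * n + 1) * ((2 * n) choose n)"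
proof -
  have "Suc n * ((2 * Suc n) choose Suc n) = 2 * (Suc n * (Suc (2 * n) choose n))"
    using Suc_times_binomial[of n "Suc (2 * n)"] by simp
  also have "Suc (2 * n) choose n = Suc (2 * n) choose Suc n"
    using binomial_symmetric[of n "Suc (2 * n)"] by (simp add: Suc_diff_le)
  also have "Suc n * \<dots> = (2 * n + 1) * ((2 * n) choose n)"
    using Suc_times_binomial[of n "2 * n"] by simp
  finally show ?thesis by simp
qed

text \<open>Both sides are 1 at \<open>n = 0\<close> and satisfy
  \<open>(n + 1) * a (n + 1) = (- (1 / 2) - n) * a n\<close>; for the right side this is
  \<open>central_binomial_Suc\<close>.\<close>

lemma gbinomial_neg_half:
  "(- (1 / 2) :: real) gchoose n = (- (1 / 4)) ^ n * real ((2 * n) choose n)"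
proof (induction n)
  case (Suc n)
  have "real (Suc n) * ((- (1 / 2) :: real) gchoose Suc n)
      = (- (1 / 2) - real n) * ((- (1 / 2)) gchoose n)"
    using gbinomial_mult_1[of "- (1 / 2) :: real" n] by (simp add: algebra_simps)
  also have "\<dots> = (- (1 / 4)) ^ Suc n * real (2 * (2 * n + 1) * ((2 * n) choose n))"
    by (simp add: Suc.IH field_simps)
  also have "\<dots> = real (Suc n) * ((- (1 / 4)) ^ Suc n * real ((2 * Suc n) choose Suc n))"
    unfolding central_binomial_Suc[symmetric] of_nat_mult by (simp only: mult_ac)
  finally show ?case
    using mult_left_cancel[of "real (Suc n)"] by (simp del: of_nat_Suc power_Suc)
qed simp

text \<open>Absorption lowers the exponent \<open>1 / 2\<close> to \<open>- (1 / 2)\<close>. Up to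
  the factor \<open>(- (1 / 4)) ^ n / 2\<close> the values are the Catalan numbers.\<close>

lemma gbinomial_half_Suc:
  "(1 / 2 :: real) gchoose Suc n = (- (1 / 4)) ^ n * real ((2 * n) choose n) / (2 * real (n + 1))"
  using gbinomial_factors[of "- (1 / 2) :: real" n] by (simp add: gbinomial_neg_half)

text \<open>Vandermonde for the exponents \<open>- 1 / 2\<close> and \<open>- 1 / 2\<close>: every
  term carries the factor \<open>(- (1 / 4)) ^ n\<close>, and the total is
  \<open>(- 1) ^ n\<close>.\<close>

lemma sum_central_binomial:
  "(\<Sum>j\<le>n. real ((2 * j) choose j) * real ((2 * (n - j)) choose (n - j))) = 4 ^ n"
proof -
  have "(- 1 :: real) gchoose n
      = (\<Sum>j\<le>n. ((- (1 / 2)) gchoose j) * ((- (1 / 2)) gchoose (n - j)))"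
    using gbinomial_Vandermonde[of "- (1 / 2) :: real" "- (1 / 2)" n] by (simp add: atLeast0AtMost)
  also have "\<dots> = (\<Sum>j\<le>n. (- (1 / 4)) ^ n *
      (real ((2 * j) choose j) * real ((2 * (n - j)) choose (n - j))))"
    by (intro sum.cong refl) (simp add: gbinomial_neg_half power_add[symmetric])
  also have "\<dots> = (- (1 / 4)) ^ n *
      (\<Sum>j\<le>n. real ((2 * j) choose j) * real ((2 * (n - j)) choose (n - j)))"
    by (simp add: sum_distrib_left)
  also have "(- 1 :: real) gchoose n = (- (1 / 4)) ^ n * 4 ^ n"
    using gbinomial_minus[of "1 :: real" n] by (simp add: power_mult_distrib[symmetric] binomial_gbinomial[symmetric])
  finally show ?thesis by simp
qed

text \<open>Vandermonde for the exponents \<open>1 / 2\<close> and \<open>- 1 / 2\<close>, whose sum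
  is 0: the terms with \<open>j \<ge> 1\<close> form the Catalan convolution and cancel the term
  \<open>j = 0\<close>, a central binomial coefficient.\<close>

lemma sum_catalan_central_binomial:
  "(\<Sum>j\<le>n. real ((2 * j) choose j) / real (j + 1) * real ((2 * (n - j)) choose (n - j)))
    = real (Suc (2 * n) choose Suc n)"
proof -
  let ?c = "\<lambda>j. real ((2 * j) choose j)"
  have "0 = (0 :: real) gchoose Suc n" by simp
  also have "\<dots> = (\<Sum>j\<le>Suc n. ((1 / 2) gchoose j) * ((- (1 / 2)) gchoose (Suc n - j)))"
    using gbinomial_Vandermonde[of "1 / 2 :: real" "- (1 / 2)" "Suc n"]
    by (simp add: atLeast0AtMost del: sum.atMost_Suc)
  also have "\<dots> = ((- (1 / 2)) gchoose Suc n)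
      + (\<Sum>j\<le>n. ((1 / 2) gchoose Suc j) * ((- (1 / 2)) gchoose (n - j)))"
    by (simp add: sum.atMost_Suc_shift del: sum.atMost_Suc)
  also have "(\<Sum>j\<le>n. ((1 / 2 :: real) gchoose Suc j) * ((- (1 / 2)) gchoose (n - j)))
      = (\<Sum>j\<le>n. (- (1 / 4)) ^ n / 2 * (?c j / real (j + 1) * ?c (n - j)))"
  proof (intro sum.cong refl)
    fix j assume "j \<in> {..n}"
    then have "(- (1 / 4) :: real) ^ n = (- (1 / 4)) ^ j * (- (1 / 4)) ^ (n - j)"
      by (simp add: power_add[symmetric])
    then show "((1 / 2 :: real) gchoose Suc j) * ((- (1 / 2)) gchoose (n - j))
        = (- (1 / 4)) ^ n / 2 * (?c j / real (j + 1) * ?c (n - j))"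
      unfolding gbinomial_half_Suc gbinomial_neg_half by simp
  qed
  \<comment> \<open>The split-off term is given the same factor \<open>(- (1 / 4)) ^ n / 2\<close>
    as the sum, with opposite sign.\<close>
  also have "((- (1 / 2) :: real) gchoose Suc n) = - ((- (1 / 4)) ^ n / 2) * (?c (Suc n) / 2)"
    by (simp only: gbinomial_neg_half) simp
  finally have "(- (1 / 4)) ^ n / 2 * (\<Sum>j\<le>n. ?c j / real (j + 1) * ?c (n - j))
      = (- (1 / 4)) ^ n / 2 * (?c (Suc n) / 2)"
    by (simp only: sum_distrib_left[symmetric])
  then have "(\<Sum>j\<le>n. ?c j / real (j + 1) * ?c (n - j)) = ?c (Suc n) / 2"
    by simp
  also have "(2 * Suc n) choose Suc n = 2 * (Suc (2 * n) choose Suc n)"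
    using binomial_symmetric[of n "Suc (2 * n)"] by (simp add: Suc_diff_le)
  finally show ?thesis by simp
qed

text \<open>By symmetry the upper half of row \<open>2 * k + 1\<close> sums to half of
  \<open>2 ^ (2 * k + 1)\<close>; the range of \<open>d\<close> omits only its first entry.\<close>

lemma sum_binomial_upper:
  "(\<Sum>d = 2..k + 2. real ((2 * k + 1) choose (k + d))) + real ((2 * k + 1) choose Suc k) = 4 ^ k"
proof -
  have "(\<Sum>d = 1..k + 1. (2 * k + 1) choose (k + d)) = (\<Sum>i\<le>k. (2 * k + 1) choose i)"
  proof (rule sum.reindex_bij_witness[where i = "\<lambda>i. k + 1 - i" and j = "\<lambda>d. k + 1 - d"])
    fix d assume "d \<in> {1..k + 1}"
    then show "(2 * k + 1) choose (k + 1 - d) = (2 * k + 1) choose (k + d)"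
      using binomial_symmetric[of "k + d" "2 * k + 1"] by simp
  qed auto
  also have "\<dots> = 4 ^ k"
    by (simp add: binomial_r_part_sum[simplified] power_mult)
  finally have *: "(\<Sum>d = 1..k + 1. (2 * k + 1) choose (k + d)) = 4 ^ k" .
  have "(\<Sum>d = 2..k + 2. (2 * k + 1) choose (k + d)) + ((2 * k + 1) choose Suc k)
      = (\<Sum>d = 1..k + 2. (2 * k + 1) choose (k + d))"
    using sum.atLeast_Suc_atMost[of 1 "k + 2" "\<lambda>d. (2 * k + 1) choose (k + d)"]
    by (simp only: Suc_1) simp
  \<comment> \<open>The top index contributes \<open>(2 * k + 1) choose (2 * k + 2) = 0\<close>. It
    is kept because the class of 1 can have \<open>k + 2\<close> elements.\<close>
  also have "\<dots> = (\<Sum>d = 1..k + 1. (2 * k + 1) choose (k + d))"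
    by simp
  also note *
  finally have "real ((\<Sum>d = 2..k + 2. (2 * k + 1) choose (k + d)) + ((2 * k + 1) choose Suc k))
      = real (4 ^ k)"
    by (rule arg_cong)
  then show ?thesis
    by (simp only: of_nat_add of_nat_sum of_nat_power of_nat_numeral)
qed

text \<open>Writing \<open>j / (j + 1) = 1 - 1 / (j + 1)\<close> splits the convolution into the two
  sums evaluated above; the added term \<open>j = 0\<close> vanishes.\<close>

lemma sum_binomial_eq:
  "(\<Sum>d = 2..k + 2. real ((2 * k + 1) choose (k + d))) =
    (\<Sum>j = 1..k. real j / real (j + 1) * real ((2 * j) choose j) *
      real ((2 * k - 2 * j) choose (k - j)))"
proof -
  let ?c = "\<lambda>j. real ((2 * j) choose j)"
  have "(\<Sum>j = 1..k. real j / real (j + 1) * ?c j * real ((2 * k - 2 * j) choose (k - j)))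
      = (\<Sum>j\<le>k. real j / real (j + 1) * ?c j * ?c (k - j))"
    by (intro sum.mono_neutral_cong_left) (auto simp: diff_mult_distrib2 not_less_eq_eq)
  also have "\<dots> = (\<Sum>j\<le>k. ?c j * ?c (k - j) - ?c j / real (j + 1) * ?c (k - j))"
    by (intro sum.cong refl) (simp add: field_simps)
  also have "\<dots> = 4 ^ k - real ((2 * k + 1) choose Suc k)"
    using sum_central_binomial[of k] sum_catalan_central_binomial[of k]
    by (simp add: sum_subtractf)
  finally show ?thesis
    using sum_binomial_upper[of k] by linarith
qed

subsection \<open>Walks on the integers\<close>

text \<open>Closure under subtracting \<open>2 * k + 3\<close> lets a class exceed its predecessor
  of the same parity by at most one. If the class of \<open>2 * i + 2\<close> is occupied, niceness
  empties that of \<open>2 * i + 3\<close>, so no negative value follows a positive one.\<close>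

definition steps :: "int \<Rightarrow> int set" where
  "steps x = (if x \<ge> 1 then {0..x + 1} else {x - 1..1})"

text \<open>The start \<open>x\<close> is not an entry of the list. The end is bounded through its
  positive part, which stands for the size of the class of \<open>2 * k\<close>.\<close>

definition walks :: "nat \<Rightarrow> int \<Rightarrow> nat \<Rightarrow> int list set" where
  "walks n x m = {zs. length zs = n \<and> (\<forall>i<n. zs ! i \<in> steps ((x # zs) ! i)) \<and>
     int m \<le> max (last (x # zs)) 0}"

lemma finite_steps [simp]: "finite (steps x)"
  by (simp add: steps_def)

lemma walks_0: "walks 0 x m = (if int m \<le> max x 0 then {[]} else {})"
  by (auto simp: walks_def)

lemma walks_Suc: "walks (Suc n) x m = (\<Union>y\<in>steps x. (#) y ` walks n y m)"
proof (rule set_eqI)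
  fix zs show "zs \<in> walks (Suc n) x m \<longleftrightarrow> zs \<in> (\<Union>y\<in>steps x. (#) y ` walks n y m)"
    by (cases zs) (auto simp: walks_def All_less_Suc2)
qed

lemma finite_walks [simp]: "finite (walks n x m)"
  by (induction n arbitrary: x) (simp_all add: walks_0 walks_Suc)

lemma card_walks_Suc: "card (walks (Suc n) x m) = (\<Sum>y\<in>steps x. card (walks n y m))"
  unfolding walks_Suc by (subst card_UN_disjoint) (auto simp: card_image)

text \<open>The successors of two neighbouring positive starts differ in a single element, which
  gives a recurrence of the shape of Pascal's rule.\<close>

lemma card_walks_Suc_pos:
  "card (walks (Suc n) (int (Suc (Suc a))) m) =
    card (walks (Suc n) (int (Suc a)) m) + card (walks n (int (Suc (Suc (Suc a)))) m)"
proof -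
  have "steps (int (Suc (Suc a))) = insert (int (Suc (Suc (Suc a)))) (steps (int (Suc a)))"
    "int (Suc (Suc (Suc a))) \<notin> steps (int (Suc a))"
    by (auto simp: steps_def)
  then show ?thesis by (simp add: card_walks_Suc del: of_nat_Suc)
qed

lemma card_walks_Suc_neg:
  "card (walks (Suc n) (- int (Suc b)) m) =
    card (walks (Suc n) (- int b) m) + card (walks n (- int (Suc (Suc b))) m)"
proof -
  have "steps (- int (Suc b)) = insert (- int (Suc (Suc b))) (steps (- int b))"
    "- int (Suc (Suc b)) \<notin> steps (- int b)"
    by (auto simp: steps_def)
  then show ?thesis by (simp add: card_walks_Suc del: of_nat_Suc)
qed

lemma steps_0: "steps 0 = {-1, 0, 1}" and steps_1: "steps 1 = {0, 1, 2}"
  by (auto simp: steps_def)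

text \<open>Truncated subtraction would give \<open>0 choose 0 = 1\<close> for \<open>N < m\<close>; with the value \<open>0\<close> there,
  Pascal's rule holds without side conditions.\<close>

definition shifted_binomial :: "nat \<Rightarrow> nat \<Rightarrow> nat \<Rightarrow> nat" where
  "shifted_binomial N m j = (if m \<le> N then (N - m) choose j else 0)"

lemma shifted_binomial_Suc_Suc:
  "shifted_binomial (Suc N) m (Suc j) = shifted_binomial N m (Suc j) + shifted_binomial N m j"
  by (auto simp: shifted_binomial_def Suc_diff_le not_le le_Suc_eq)

text \<open>Outer induction on the length, inner induction on the distance of the start from 1 or 0.
  The inner step is one use of Pascal's rule; the starts 1 and 0, with three successors each, take
  two uses and link both formulas.\<close>

lemma card_walks:
  "card (walks n (int (Suc a)) m) = shifted_binomial (2 * n + Suc a) m n"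
  "card (walks n (- int b) m) = shifted_binomial (2 * n + b + 1) m (n + b + 1)"
proof (induction n arbitrary: a b)
  case 0
  {
    case 1
    show ?case by (auto simp: walks_0 shifted_binomial_def)
  next
    case 2
    show ?case by (cases m) (auto simp: walks_0 shifted_binomial_def)
  }
next
  case (Suc n)
  note IH = Suc.IH
  have zero: "card (walks n 0 m) = shifted_binomial (2 * n + 1) m (n + 1)"
    using IH(2)[of 0] by simp
  have one: "card (walks n 1 m) = shifted_binomial (2 * n + 1) m n"
    using IH(1)[of 0] by simp
  {
    case (1 a)
    show ?case
    proof (induction a)
      case 0
      show ?case
        using IH(1)[of 1]
        by (simp add: card_walks_Suc steps_1 zero one shifted_binomial_Suc_Suc)
    next
      case (Suc a)
      then show ?case
        by (simp add: card_walks_Suc_pos IH shifted_binomial_Suc_Suc del: of_nat_Suc)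
    qed
  next
    case (2 b)
    show ?case
    proof (induction b)
      case 0
      show ?case
        using IH(2)[of 1]
        by (simp add: card_walks_Suc steps_0 zero one shifted_binomial_Suc_Suc)
    next
      case (Suc b)
      then show ?case
        by (simp add: card_walks_Suc_neg IH shifted_binomial_Suc_Suc del: of_nat_Suc)
    qed
  }
qed

subsection \<open>Residue classes of the poset\<close>

lemma mult_add_eq_iff:
  fixes q r s :: nat
  assumes "r < s" "r' < s"
  shows "q * s + r = q' * s + r' \<longleftrightarrow> q = q' \<and> r = r'"
proof
  assume eq: "q * s + r = q' * s + r'"
  have "(q * s + r) div s = q" "(q' * s + r') div s = q'"
    "(q * s + r) mod s = r" "(q' * s + r') mod s = r'"
    using assms by simp_all
  then show "q = q' \<and> r = r'" using eq by metis
qed simp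

text \<open>\<open>k1 * (2 * k + 1) + k2 * (2 * k + 3)\<close> regroups with
  \<open>m = k1 + k2\<close> and \<open>b = k2\<close>, so \<open>b \<le> m\<close> is the only
  constraint.\<close>

lemma core_set_iff:
  "x \<in> core_set (2 * k + 1) (2 * k + 3) \<longleftrightarrow>
    0 < x \<and> (\<forall>m b. b \<le> m \<longrightarrow> x \<noteq> m * (2 * k + 1) + 2 * b)"
proof -
  have "(\<exists>k1 k2. x = k1 * (2 * k + 1) + k2 * (2 * k + 3)) \<longleftrightarrow>
      (\<exists>m b. b \<le> m \<and> x = m * (2 * k + 1) + 2 * b)"
  proof safe
    fix k1 k2
    show "\<exists>m b. b \<le> m \<and> k1 * (2 * k + 1) + k2 * (2 * k + 3) = m * (2 * k + 1) + 2 * b"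
      by (intro exI[of _ "k1 + k2"] exI[of _ k2]) (simp add: algebra_simps)
  next
    fix m b :: nat assume "b \<le> m"
    then obtain a where "m = b + a" using le_Suc_ex by blast
    then show "\<exists>k1 k2. m * (2 * k + 1) + 2 * b = k1 * (2 * k + 1) + k2 * (2 * k + 3)"
      by (intro exI[of _ a] exI[of _ b]) (simp add: algebra_simps)
  qed
  then show ?thesis by (auto simp: core_set_def)
qed

text \<open>Call \<open>n\<close> the row. Taking \<open>m = n\<close> requires
  \<open>b = i + 1\<close>; a larger \<open>m\<close> overshoots, and a smaller \<open>m\<close>
  requires a larger \<open>b\<close> under a smaller bound.\<close>

lemma even_residue_in_core_set_iff:
  assumes "i < k"
  shows "n * (2 * k + 1) + (2 * i + 2) \<in> core_set (2 * k + 1) (2 * k + 3) \<longleftrightarrow> n \<le> i"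
proof
  assume *: "n * (2 * k + 1) + (2 * i + 2) \<in> core_set (2 * k + 1) (2 * k + 3)"
  show "n \<le> i"
  proof (rule ccontr)
    assume "\<not> n \<le> i"
    then have "i + 1 \<le> n" by simp
    with * have "n * (2 * k + 1) + (2 * i + 2) \<noteq> n * (2 * k + 1) + 2 * (i + 1)"
      unfolding core_set_iff by blast
    then show False by simp
  qed
next
  assume "n \<le> i"
  have "n * (2 * k + 1) + (2 * i + 2) \<noteq> m * (2 * k + 1) + 2 * b" if "b \<le> m" for m b
  proof
    assume eq: "n * (2 * k + 1) + (2 * i + 2) = m * (2 * k + 1) + 2 * b"
    consider "m = n" | "m > n" | "m < n" by linarith
    then show False
    proof cases
      case 1
      with eq \<open>b \<le> m\<close> \<open>n \<le> i\<close> show False by simp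
    next
      case 2
      then have "(n + 1) * (2 * k + 1) \<le> m * (2 * k + 1)" by (intro mult_le_mono1) simp
      with eq \<open>i < k\<close> show False by simp
    next
      case 3
      then have "(m + 1) * (2 * k + 1) \<le> n * (2 * k + 1)" by (intro mult_le_mono1) simp
      with eq \<open>b \<le> m\<close> \<open>n \<le> i\<close> 3 show False by simp
    qed
  qed
  then show "n * (2 * k + 1) + (2 * i + 2) \<in> core_set (2 * k + 1) (2 * k + 3)"
    unfolding core_set_iff by simp
qed

text \<open>Parity excludes \<open>m = n\<close>. The best choice is \<open>m = n - 1\<close>, which
  leaves \<open>(2 * k + 1) + (2 * i + 1) = 2 * (k + 1 + i)\<close>.\<close>

lemma odd_residue_in_core_set_iff:
  assumes "i < k"
  shows "n * (2 * k + 1) + (2 * i + 1) \<in> core_set (2 * k + 1) (2 * k + 3) \<longleftrightarrow> n \<le> k + 1 + i"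
proof
  assume *: "n * (2 * k + 1) + (2 * i + 1) \<in> core_set (2 * k + 1) (2 * k + 3)"
  show "n \<le> k + 1 + i"
  proof (rule ccontr)
    assume n: "\<not> n \<le> k + 1 + i"
    then obtain m where m: "n = Suc m" by (cases n) auto
    with n have "k + 1 + i \<le> m" by simp
    with * have "n * (2 * k + 1) + (2 * i + 1) \<noteq> m * (2 * k + 1) + 2 * (k + 1 + i)"
      unfolding core_set_iff by blast
    with m show False by simp
  qed
next
  assume "n \<le> k + 1 + i"
  have "n * (2 * k + 1) + (2 * i + 1) \<noteq> m * (2 * k + 1) + 2 * b" if "b \<le> m" for m b
  proof
    assume eq: "n * (2 * k + 1) + (2 * i + 1) = m * (2 * k + 1) + 2 * b"
    consider "m = n" | "m > n" | "m < n" by linarith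
    then show False
    proof cases
      case 1
      with eq show False by simp presburger
    next
      case 2
      then have "(n + 1) * (2 * k + 1) \<le> m * (2 * k + 1)" by (intro mult_le_mono1) simp
      with eq \<open>i < k\<close> show False by simp
    next
      case 3
      then have "(m + 1) * (2 * k + 1) \<le> n * (2 * k + 1)" by (intro mult_le_mono1) simp
      with eq \<open>b \<le> m\<close> \<open>n \<le> k + 1 + i\<close> 3 show False by simp
    qed
  qed
  then show "n * (2 * k + 1) + (2 * i + 1) \<in> core_set (2 * k + 1) (2 * k + 3)"
    unfolding core_set_iff by simp
qed

lemma core_set_cases:
  assumes "x \<in> core_set (2 * k + 1) (2 * k + 3)"
  obtains (even_residue) n i where "i < k" "n \<le> i" "x = n * (2 * k + 1) + (2 * i + 2)"
  | (odd_residue) n i where "i < k" "n \<le> k + 1 + i" "x = n * (2 * k + 1) + (2 * i + 1)"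
proof -
  define n where "n = x div (2 * k + 1)"
  define r where "r = x mod (2 * k + 1)"
  have x: "x = n * (2 * k + 1) + r" unfolding n_def r_def by (rule div_mult_mod_eq[symmetric])
  have "r \<noteq> 0"
  proof
    assume "r = 0"
    then have "x = n * (2 * k + 1) + 2 * 0" using x by simp
    with assms show False unfolding core_set_iff by blast
  qed
  have "r < 2 * k + 1" unfolding r_def by simp
  show thesis
  proof (cases "even r")
    case True
    then obtain j where "r = 2 * j" by blast
    with \<open>r \<noteq> 0\<close> obtain i where "r = 2 * i + 2" by (cases j) auto
    with assms x \<open>r < _\<close> even_residue[of i n] even_residue_in_core_set_iff[of i k n] show thesis
      by auto
  next
    case False
    then obtain i where "r = 2 * i + 1" by (elim oddE)
    with assms x \<open>r < _\<close> odd_residue[of i n] odd_residue_in_core_set_iff[of i k n] show thesis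
      by auto
  qed
qed

text \<open>The order is generated by covers, so closure under one cover propagates along
  chains.\<close>

lemma order_ideal_iff_covers:
  "order_ideal s t I \<longleftrightarrow> I \<subseteq> core_set s t \<and> (\<forall>y\<in>I. \<forall>x. covers s t y x \<longrightarrow> x \<in> I)"
proof
  assume "order_ideal s t I"
  then show "I \<subseteq> core_set s t \<and> (\<forall>y\<in>I. \<forall>x. covers s t y x \<longrightarrow> x \<in> I)"
    by (auto simp: order_ideal_def core_le_def covers_def)
next
  assume I: "I \<subseteq> core_set s t \<and> (\<forall>y\<in>I. \<forall>x. covers s t y x \<longrightarrow> x \<in> I)"
  have "x \<in> I" if "core_le s t x y" "y \<in> I" for x y
    using that(1) unfolding core_le_def
    by (induction rule: converse_rtranclp_induct) (use I that(2) in auto)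
  with I show "order_ideal s t I"
    by (auto simp: order_ideal_def)
qed

subsection \<open>Ideals as walks\<close>

text \<open>One integer records both class sizes: its positive part for the even residue, its
  negative part for the odd one.\<close>

definition ideal_of :: "nat \<Rightarrow> int list \<Rightarrow> nat set" where
  "ideal_of k zs =
    {n * (2 * k + 1) + (2 * i + 2) | n i. i < k \<and> int n < zs ! i} \<union>
    {n * (2 * k + 1) + (2 * i + 1) | n i. i < k \<and> int n < - (zs ! i)}"

lemma ideal_of_cases:
  assumes "x \<in> ideal_of k zs"
  obtains (even_residue) n i where "i < k" "int n < zs ! i" "x = n * (2 * k + 1) + (2 * i + 2)"
  | (odd_residue) n i where "i < k" "int n < - (zs ! i)" "x = n * (2 * k + 1) + (2 * i + 1)"
  using assms unfolding ideal_of_def by blast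

lemma even_residue_in_ideal_of_iff:
  assumes "i < k"
  shows "n * (2 * k + 1) + (2 * i + 2) \<in> ideal_of k zs \<longleftrightarrow> int n < zs ! i"
    (is "?x \<in> _ \<longleftrightarrow> _")
proof
  assume "?x \<in> ideal_of k zs"
  then show "int n < zs ! i"
  proof (cases rule: ideal_of_cases)
    case (even_residue n' i')
    then have "n = n' \<and> 2 * i + 2 = 2 * i' + 2"
      using assms by (intro mult_add_eq_iff[of _ "2 * k + 1", THEN iffD1]) auto
    with even_residue show ?thesis by simp
  next
    case (odd_residue n' i')
    then have "n = n' \<and> 2 * i + 2 = 2 * i' + 1"
      using assms by (intro mult_add_eq_iff[of _ "2 * k + 1", THEN iffD1]) auto
    then show ?thesis by presburger
  qed
next
  assume "int n < zs ! i"
  with assms show "?x \<in> ideal_of k zs" unfolding ideal_of_def by blast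
qed

lemma odd_residue_in_ideal_of_iff:
  assumes "i < k"
  shows "n * (2 * k + 1) + (2 * i + 1) \<in> ideal_of k zs \<longleftrightarrow> int n < - (zs ! i)"
    (is "?x \<in> _ \<longleftrightarrow> _")
proof
  assume "?x \<in> ideal_of k zs"
  then show "int n < - (zs ! i)"
  proof (cases rule: ideal_of_cases)
    case (odd_residue n' i')
    then have "n = n' \<and> 2 * i + 1 = 2 * i' + 1"
      using assms by (intro mult_add_eq_iff[of _ "2 * k + 1", THEN iffD1]) auto
    with odd_residue show ?thesis by simp
  next
    case (even_residue n' i')
    then have "n = n' \<and> 2 * i + 1 = 2 * i' + 2"
      using assms by (intro mult_add_eq_iff[of _ "2 * k + 1", THEN iffD1]) auto
    then show ?thesis by presburger
  qed
next
  assume "int n < - (zs ! i)"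
  with assms show "?x \<in> ideal_of k zs" unfolding ideal_of_def by blast
qed

text \<open>Testing at \<open>nat x\<close> and \<open>nat (- x)\<close> recovers the positive and
  negative parts, which determine an integer.\<close>

lemma eq_if_same_nats_below:
  fixes x y :: int
  assumes "\<And>n. int n < x \<longleftrightarrow> int n < y" and "\<And>n. int n < - x \<longleftrightarrow> int n < - y"
  shows "x = y"
proof -
  have "max x 0 = max y 0"
    using assms(1)[of "nat x"] assms(1)[of "nat y"] by linarith
  moreover have "max (- x) 0 = max (- y) 0"
    using assms(2)[of "nat (- x)"] assms(2)[of "nat (- y)"] by linarith
  ultimately show ?thesis by linarith
qed

lemma inj_on_ideal_of: "inj_on (ideal_of k) {zs. length zs = k}"
proof (rule inj_onI, clarsimp)
  fix ys zs :: "int list"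
  assume len: "length zs = length ys" and eq: "ideal_of (length ys) ys = ideal_of (length ys) zs"
  show "ys = zs"
  proof (intro nth_equalityI eq_if_same_nats_below)
    fix i n assume i: "i < length ys"
    show "int n < ys ! i \<longleftrightarrow> int n < zs ! i" "int n < - (ys ! i) \<longleftrightarrow> int n < - (zs ! i)"
      using even_residue_in_ideal_of_iff[OF i, of n] odd_residue_in_ideal_of_iff[OF i, of n] eq
      by blast+
  qed (use len in simp)
qed

text \<open>The value \<open>- (zs ! 0)\<close> counts the elements of the ideal that are \<open>1\<close> modulo \<open>2 * k + 1\<close>.
  Since \<open>(n + 2) * (2 * k + 1) + 1\<close> covers \<open>n * (2 * k + 1) + 2 * k\<close>, it is bounded in terms of the
  last entry, which closes the walk cyclically.\<close>

definition ideal_walks :: "nat \<Rightarrow> int list set" where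
  "ideal_walks k = {zs. length zs = k \<and> zs ! 0 \<le> -2 \<and> - int (k + 2) \<le> zs ! 0 \<and>
     (\<forall>i. Suc i < k \<longrightarrow> zs ! Suc i \<in> steps (zs ! i)) \<and> - (zs ! 0) \<le> max (zs ! (k - 1)) 0 + 2}"

text \<open>The first entry \<open>- d\<close> becomes the start, and the cyclic closing condition
  becomes the end bound \<open>d - 2\<close>.\<close>

lemma ideal_walks_eq:
  "ideal_walks (Suc k) = (\<Union>d\<in>{2..k + 3}. (#) (- int d) ` walks k (- int d) (d - 2))"
proof (intro set_eqI iffI)
  fix zs assume zs: "zs \<in> ideal_walks (Suc k)"
  then obtain z ws where "zs = z # ws" by (cases zs) (auto simp: ideal_walks_def)
  moreover define d where "d = nat (- z)"
  ultimately have "zs = - int d # ws" "2 \<le> d" "d \<le> k + 3"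
    using zs by (auto simp: ideal_walks_def)
  moreover from this have "ws \<in> walks k (- int d) (d - 2)"
    using zs by (auto simp: ideal_walks_def walks_def last_conv_nth)
  ultimately show "zs \<in> (\<Union>d\<in>{2..k + 3}. (#) (- int d) ` walks k (- int d) (d - 2))"
    by auto
next
  fix zs assume "zs \<in> (\<Union>d\<in>{2..k + 3}. (#) (- int d) ` walks k (- int d) (d - 2))"
  then show "zs \<in> ideal_walks (Suc k)"
    by (auto simp: ideal_walks_def walks_def last_conv_nth nth_Cons')
qed

lemma card_ideal_walks:
  assumes "k \<ge> 1"
  shows "card (ideal_walks k) = (\<Sum>d = 2..k + 2. (2 * k + 1) choose (k + d))"
proof -
  obtain l where k: "k = Suc l" using assms by (cases k) auto
  have "card (ideal_walks (Suc l)) = (\<Sum>d\<in>{2..l + 3}. card (walks l (- int d) (d - 2)))"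
    unfolding ideal_walks_eq by (subst card_UN_disjoint) (auto simp: card_image)
  also have "\<dots> = (\<Sum>d\<in>{2..l + 3}. (2 * k + 1) choose (k + d))"
  proof (intro sum.cong refl)
    fix d assume "d \<in> {2..l + 3}"
    \<comment> \<open>Here \<open>d\<close> cancels in the upper index, so all counts lie in one row
      of Pascal's triangle.\<close>
    then have "2 * l + d + 1 - (d - 2) = 2 * k + 1" "l + d + 1 = k + d"
      "d - 2 \<le> 2 * l + d + 1"
      by (auto simp: k)
    then show "card (walks l (- int d) (d - 2)) = (2 * k + 1) choose (k + d)"
      unfolding card_walks shifted_binomial_def by (simp only: if_True)
  qed
  also have "l + 3 = k + 2" by (simp add: k)
  finally show ?thesis unfolding k .
qed

section \<open>From walks to nice ideals\<close>

lemma ideal_of_nice_ideal: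
  assumes zs: "zs \<in> ideal_walks k" and "k \<ge> 1"
  shows "order_ideal (2 * k + 1) (2 * k + 3) (ideal_of k zs)" "nice (ideal_of k zs)"
    "2 * k + 2 \<in> ideal_of k zs"
proof -
  have step: "zs ! Suc i \<in> steps (zs ! i)" if "Suc i < k" for i
    using zs that by (simp add: ideal_walks_def)
  have z0: "zs ! 0 \<le> -2" "- int (k + 2) \<le> zs ! 0" "- (zs ! 0) \<le> max (zs ! (k - 1)) 0 + 2"
    using zs by (simp_all add: ideal_walks_def)
  \<comment> \<open>Each step moves the bounds by one, just as the classes of the poset grow with
    \<open>i\<close>; hence the encoded set stays inside the poset.\<close>
  have bounds: "- int (k + 2 + i) \<le> zs ! i \<and> zs ! i \<le> int i" if "i < k" for i
    using that
  proof (induction i)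
    case 0
    then show ?case using z0 by simp
  next
    case (Suc i)
    then show ?case using step[of i] by (auto simp: steps_def split: if_splits)
  qed
  have sub: "ideal_of k zs \<subseteq> core_set (2 * k + 1) (2 * k + 3)"
  proof
    fix x assume "x \<in> ideal_of k zs"
    then show "x \<in> core_set (2 * k + 1) (2 * k + 3)"
    proof (cases rule: ideal_of_cases)
      case (even_residue n i)
      then show ?thesis using bounds[of i] even_residue_in_core_set_iff[of i k n] by force
    next
      case (odd_residue n i)
      then show ?thesis using bounds[of i] odd_residue_in_core_set_iff[of i k n] by force
    qed
  qed
  moreover have "x \<in> ideal_of k zs"
    if y: "y \<in> ideal_of k zs" and cov: "covers (2 * k + 1) (2 * k + 3) y x" for x y
  proof -
    have eq: "y = x + (2 * k + 1) \<or> y = x + (2 * k + 3)"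
      using cov by (simp add: covers_def)
    have "x \<in> core_set (2 * k + 1) (2 * k + 3)"
      using cov by (simp add: covers_def)
    then show ?thesis
    proof (cases rule: core_set_cases)
      case x: (even_residue n i)
      from eq show ?thesis
      proof
        assume "y = x + (2 * k + 1)"
        then have "y = (n + 1) * (2 * k + 1) + (2 * i + 2)" using x by simp
        then have "int (n + 1) < zs ! i"
          using y even_residue_in_ideal_of_iff[OF x(1), of "n + 1" zs] by simp
        then show ?thesis
          using even_residue_in_ideal_of_iff[OF x(1), of n zs] x by simp
      next
        assume y': "y = x + (2 * k + 3)"
        show ?thesis
        proof (cases "Suc i < k")
          case True
          have "y = (n + 1) * (2 * k + 1) + (2 * Suc i + 2)" using x y' by simp
          then have "int (n + 1) < zs ! Suc i"
            using y even_residue_in_ideal_of_iff[OF True, of "n + 1" zs] by simp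
          then have "int n < zs ! i"
            using step[OF True] by (auto simp: steps_def split: if_splits)
          then show ?thesis
            using even_residue_in_ideal_of_iff[OF x(1), of n zs] x by simp
        next
          case False
          then have i: "i = k - 1" using x by simp
          have "0 < k" using assms by simp
          \<comment> \<open>Adding \<open>2 * k + 3\<close> to residue \<open>2 * k\<close> lands in
            residue 1 two rows higher, where the closing condition applies.\<close>
          have "y = (n + 2) * (2 * k + 1) + (2 * 0 + 1)"
            using x y' i \<open>0 < k\<close> by (simp add: algebra_simps)
          then have "int (n + 2) < - (zs ! 0)"
            using y odd_residue_in_ideal_of_iff[OF \<open>0 < k\<close>, of "n + 2" zs] by simp
          then have "int n < zs ! i" using z0 i by simp
          then show ?thesis
            using even_residue_in_ideal_of_iff[OF x(1), of n zs] x by simp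
        qed
      qed
    next
      case x: (odd_residue n i)
      from eq show ?thesis
      proof
        assume "y = x + (2 * k + 1)"
        then have "y = (n + 1) * (2 * k + 1) + (2 * i + 1)" using x by simp
        then have "int (n + 1) < - (zs ! i)"
          using y odd_residue_in_ideal_of_iff[OF x(1), of "n + 1" zs] by simp
        then show ?thesis
          using odd_residue_in_ideal_of_iff[OF x(1), of n zs] x by simp
      next
        assume y': "y = x + (2 * k + 3)"
        show ?thesis
        proof (cases "Suc i < k")
          case True
          have "y = (n + 1) * (2 * k + 1) + (2 * Suc i + 1)" using x y' by simp
          then have "int (n + 1) < - (zs ! Suc i)"
            using y odd_residue_in_ideal_of_iff[OF True, of "n + 1" zs] by simp
          then have "int n < - (zs ! i)"
            using step[OF True] by (auto simp: steps_def split: if_splits)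
          then show ?thesis
            using odd_residue_in_ideal_of_iff[OF x(1), of n zs] x by simp
        next
          case False
          then have i: "i = k - 1" using x by simp
          \<comment> \<open>From residue \<open>2 * k - 1\<close> the sum is a multiple of
            \<open>2 * k + 1\<close>, so it is not in the poset.\<close>
          then have "y = (n + 2) * (2 * k + 1) + 2 * 0"
            using x y' assms by (simp add: algebra_simps)
          moreover have "y \<in> core_set (2 * k + 1) (2 * k + 3)" using y sub by blast
          ultimately show ?thesis unfolding core_set_iff by blast
        qed
      qed
    qed
  qed
  ultimately show "order_ideal (2 * k + 1) (2 * k + 3) (ideal_of k zs)"
    unfolding order_ideal_iff_covers by blast
  show "nice (ideal_of k zs)"
    unfolding nice_def
  proof safe
    fix y assume y1: "y + 1 \<in> ideal_of k zs" and "y \<in> ideal_of k zs"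
    from this(2) show False
    proof (cases rule: ideal_of_cases)
      case y: (even_residue n i)
      show False
      proof (cases "Suc i < k")
        case True
        have "y + 1 = n * (2 * k + 1) + (2 * Suc i + 1)" using y by simp
        then have "int n < - (zs ! Suc i)"
          using y1 odd_residue_in_ideal_of_iff[OF True, of n zs] by simp
        then show False
          using y step[OF True] by (auto simp: steps_def split: if_splits)
      next
        case False
        then have "y + 1 = (n + 1) * (2 * k + 1) + 2 * 0"
          using y by simp
        moreover have "y + 1 \<in> core_set (2 * k + 1) (2 * k + 3)" using y1 sub by blast
        ultimately show False unfolding core_set_iff by blast
      qed
    next
      case y: (odd_residue n i)
      then have "y + 1 = n * (2 * k + 1) + (2 * i + 2)" by simp
      then have "int n < zs ! i"
        using y1 even_residue_in_ideal_of_iff[OF y(1), of n zs] by simp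
      with y show False by simp
    qed
  qed
  show "2 * k + 2 \<in> ideal_of k zs"
    \<comment> \<open>\<open>2 * k + 2\<close> is row 1 of residue 1, so it needs a class of size at
      least 2.\<close>
    using odd_residue_in_ideal_of_iff[of 0 k 1 zs] z0 assms by simp
qed

section \<open>From nice ideals to walks\<close>

lemma down_closed_initial_segment:
  fixes P :: "nat \<Rightarrow> bool"
  assumes "\<And>n. P (Suc n) \<Longrightarrow> P n" and "\<And>n. P n \<Longrightarrow> n \<le> b"
  obtains c where "\<And>n. P n \<longleftrightarrow> n < c"
proof
  fix n
  have down: "P m \<Longrightarrow> j \<le> m \<Longrightarrow> P j" for m j
    by (induction m) (auto simp: le_Suc_eq intro: assms(1))
  have ex: "\<not> P (Suc b)" using assms(2) by force
  show "P n \<longleftrightarrow> n < (LEAST m. \<not> P m)"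
    using LeastI[of "\<lambda>m. \<not> P m", OF ex] not_less_Least[of n "\<lambda>m. \<not> P m"] down[of n]
    by (meson not_less)
qed

text \<open>The class sizes \<open>F i\<close> and \<open>G i\<close> are read off from
  \<open>I\<close>; covers and pairs of neighbours in \<open>I\<close> yield the conditions on the
  walk.\<close>

lemma nice_ideal_in_image:
  assumes I: "order_ideal (2 * k + 1) (2 * k + 3) I" and "nice I" and "2 * k + 2 \<in> I" and "k \<ge> 1"
  shows "I \<in> ideal_of k ` ideal_walks k"
proof -
  define E where "E n i \<longleftrightarrow> n * (2 * k + 1) + (2 * i + 2) \<in> I" for n i
  define O' where "O' n i \<longleftrightarrow> n * (2 * k + 1) + (2 * i + 1) \<in> I" for n i
  have sub: "I \<subseteq> core_set (2 * k + 1) (2 * k + 3)"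
    using I by (simp add: order_ideal_def)
  have E_le: "n \<le> i" if "E n i" "i < k" for n i
    using that sub even_residue_in_core_set_iff[of i k n] unfolding E_def by blast
  have O_le: "n \<le> k + 1 + i" if "O' n i" "i < k" for n i
    using that sub odd_residue_in_core_set_iff[of i k n] unfolding O'_def by blast
  have closed: "x \<in> I" if "y \<in> I" "x \<in> core_set (2 * k + 1) (2 * k + 3)"
    "y = x + (2 * k + 1) \<or> y = x + (2 * k + 3)" for x y
    using that I sub unfolding order_ideal_iff_covers covers_def by blast
  have E_down: "E n i" if "E (Suc n) i" "i < k" for n i
    using E_le[OF that] that(1) unfolding E_def
    by (elim closed) (simp_all only: even_residue_in_core_set_iff[OF that(2)], simp_all)
  have O_down: "O' n i" if "O' (Suc n) i" "i < k" for n i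
    using O_le[OF that] that(1) unfolding O'_def
    by (elim closed) (simp_all only: odd_residue_in_core_set_iff[OF that(2)], simp_all)
  have E_diag: "E n i" if "E (Suc n) (Suc i)" "Suc i < k" for n i
    using E_le[OF that] that(1) unfolding E_def
    by (elim closed) (simp_all only: even_residue_in_core_set_iff[OF Suc_lessD[OF that(2)]], simp_all)
  have O_diag: "O' n i" if "O' (Suc n) (Suc i)" "Suc i < k" for n i
    using O_le[OF that] that(1) unfolding O'_def
    by (elim closed) (simp_all only: odd_residue_in_core_set_iff[OF Suc_lessD[OF that(2)]], simp_all)
  \<comment> \<open>Subtracting \<open>2 * k + 3\<close> from row \<open>n + 2\<close> of residue 1
    gives row \<open>n\<close> of residue \<open>2 * k\<close>.\<close>
  have wrap: "E n (k - 1)" if "O' (n + 2) 0" for n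
  proof -
    have "k - 1 < k" "n \<le> k - 1" using O_le[OF that] assms(4) by simp_all
    then show ?thesis
      using that assms(4) unfolding E_def O'_def
      by (elim closed) (simp_all only: even_residue_in_core_set_iff, simp_all add: algebra_simps)
  qed
  have "\<exists>f. \<forall>n. E n i \<longleftrightarrow> n < f" if "i < k" for i
    using down_closed_initial_segment[of "\<lambda>n. E n i" i] E_down E_le that by metis
  then obtain F where F: "\<And>n i. i < k \<Longrightarrow> E n i \<longleftrightarrow> n < F i" by metis
  have "\<exists>g. \<forall>n. O' n i \<longleftrightarrow> n < g" if "i < k" for i
    using down_closed_initial_segment[of "\<lambda>n. O' n i" "k + 1 + i"] O_down O_le that by metis
  then obtain G where G: "\<And>n i. i < k \<Longrightarrow> O' n i \<longleftrightarrow> n < G i" by metis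
  \<comment> \<open>A nonempty initial segment contains row 0, so niceness is tested only
    there.\<close>
  have FG: "F i = 0 \<or> G i = 0" if "i < k" for i
    using F[OF that, of 0] G[OF that, of 0] \<open>nice I\<close> by (force simp: nice_def E_def O'_def)
  have FG_Suc: "F i = 0 \<or> G (Suc i) = 0" if "Suc i < k" for i
    using F[of i 0] G[OF that, of 0] that \<open>nice I\<close> by (force simp: nice_def E_def O'_def)
  \<comment> \<open>Otherwise row \<open>F i + 1\<close> of the next class would force row
    \<open>F i\<close>, the first missing one, into this class.\<close>
  have F_Suc: "F (Suc i) \<le> F i + 1" if "Suc i < k" for i
    using F[of i "F i"] F[OF that, of "Suc (F i)"] E_diag[of "F i" i] that by force
  have G_Suc: "G (Suc i) \<le> G i + 1" if "Suc i < k" for i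
    using G[of i "G i"] G[OF that, of "Suc (G i)"] O_diag[of "G i" i] that by force
  have "0 < k" using assms by simp
  have G0_le: "G 0 \<le> F (k - 1) + 2"
    using F[of "k - 1" "F (k - 1)"] G[of 0 "F (k - 1) + 2"] wrap[of "F (k - 1)"] \<open>0 < k\<close> by force
  have G0_ge: "2 \<le> G 0"
    using G[OF \<open>0 < k\<close>, of 1] \<open>2 * k + 2 \<in> I\<close> by (simp add: O'_def)
  have G0_le': "G 0 \<le> k + 2"
    using G[OF \<open>0 < k\<close>, of "k + 2"] O_le[of "k + 2" 0] \<open>0 < k\<close> by force
  \<comment> \<open>One of \<open>F i\<close> and \<open>G i\<close> is 0, so the difference still
    determines both.\<close>
  define zs where "zs = map (\<lambda>i. int (F i) - int (G i)) [0..<k]"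
  have nth: "zs ! i = int (F i) - int (G i)" if "i < k" for i
    using that by (simp add: zs_def)
  have "zs \<in> ideal_walks k"
    unfolding ideal_walks_def
  proof (intro CollectI conjI allI impI)
    show "length zs = k" by (simp add: zs_def)
    show "zs ! 0 \<le> - 2" "- int (k + 2) \<le> zs ! 0"
      using FG[OF \<open>0 < k\<close>] G0_ge G0_le' nth[OF \<open>0 < k\<close>] by auto
    show "- (zs ! 0) \<le> max (zs ! (k - 1)) 0 + 2"
      using FG[of "k - 1"] G0_le nth[OF \<open>0 < k\<close>] nth[of "k - 1"] \<open>0 < k\<close> by auto
    fix i assume "Suc i < k"
    then show "zs ! Suc i \<in> steps (zs ! i)"
      using FG[of i] FG[of "Suc i"] FG_Suc[of i] F_Suc[of i] G_Suc[of i] nth[of i] nth[of "Suc i"]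
      by (auto simp: steps_def)
  qed
  moreover have "I = ideal_of k zs"
  proof (rule set_eqI)
    fix x
    have E_iff: "E n i \<longleftrightarrow> n * (2 * k + 1) + (2 * i + 2) \<in> ideal_of k zs" if "i < k" for n i
      using even_residue_in_ideal_of_iff[OF that, of n zs] F[OF that, of n] FG[OF that] nth[OF that]
      by auto
    have O_iff: "O' n i \<longleftrightarrow> n * (2 * k + 1) + (2 * i + 1) \<in> ideal_of k zs" if "i < k" for n i
      using odd_residue_in_ideal_of_iff[OF that, of n zs] G[OF that, of n] FG[OF that] nth[OF that]
      by auto
    show "x \<in> I \<longleftrightarrow> x \<in> ideal_of k zs"
    proof
      assume "x \<in> I"
      then have "x \<in> core_set (2 * k + 1) (2 * k + 3)" using sub by blast
      then show "x \<in> ideal_of k zs"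
        by (cases rule: core_set_cases) (use \<open>x \<in> I\<close> E_iff O_iff E_def O'_def in auto)
    next
      assume "x \<in> ideal_of k zs"
      then show "x \<in> I"
        by (cases rule: ideal_of_cases) (use \<open>x \<in> ideal_of k zs\<close> E_iff O_iff E_def O'_def in auto)
    qed
  qed
  ultimately show ?thesis by blast
qed

theorem theorem5:
  fixes k :: nat
  assumes "k \<ge> 1"
  shows "real (card {I. order_ideal (2 * k + 1) (2 * k + 3) I \<and> nice I \<and> 2 * k + 2 \<in> I}) =
    (\<Sum>j = 1..k. real j / real (j + 1) * real ((2 * j) choose j) * real ((2 * k - 2 * j) choose (k - j)))"
proof -
  have "{I. order_ideal (2 * k + 1) (2 * k + 3) I \<and> nice I \<and> 2 * k + 2 \<in> I}
      = ideal_of k ` ideal_walks k"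
    using ideal_of_nice_ideal[OF _ assms] nice_ideal_in_image[OF _ _ _ assms] by blast
  moreover have "inj_on (ideal_of k) (ideal_walks k)"
    by (rule inj_on_subset[OF inj_on_ideal_of]) (auto simp: ideal_walks_def)
  ultimately have "card {I. order_ideal (2 * k + 1) (2 * k + 3) I \<and> nice I \<and> 2 * k + 2 \<in> I}
      = (\<Sum>d = 2..k + 2. (2 * k + 1) choose (k + d))"
    by (simp only: card_image card_ideal_walks[OF assms])
  then show ?thesis
    by (simp only: of_nat_sum sum_binomial_eq)
qed

end
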